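(* Let $\mathcal G$ (resp. $\mathcal F$) be the set of nonexpansive real-valued maps over a set equipped with a weak metric $(X,\delta)$ (resp. $(Y,\delta')$). Assume that $(X,\delta)$ satisfies either i) that the closed balls of $(X,\delta_s)$ are compact, or ii) that $\delta=\frac12\delta_s$ and $(X,\delta_s)$ is complete; and that the same is true for $(Y,\delta')$. Then every (max,+)-isomorphism $J$ from $\mathcal F$ onto $\mathcal G$ is of the form $$Jf(x)=g(x)+f(\phi(x))$$ where $g:X\to\mathbb R$ is nonexpansive and $\phi:X\to Y$ is such that $g(x)-g(x')+\delta'(\phi(x),\phi(x'))=\delta(x,x')$ for all $x,x'\in X$. If both $\delta$ and $\delta'$ are metrics, then $g$ is constant and $\delta'(\phi(x),\phi(x'))=\delta(x,x')$ for all $x,x'\in X$.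
   Context: A weak metric on a set $X$ is a map $\delta:X\times X\to\mathbb R$ (possibly asymmetric and with negative values) such that $\delta(x,z)\le\delta(x,y)+\delta(y,z)$ for all $x,y,z\in X$ and such that $\delta_s(x,y):=\delta(x,y)+\delta(y,x)$ is an ordinary metric on $X$. A map $f:X\to\mathbb R$ is nonexpansive (1-Lipschitz) with respect to $\delta$ if $f(x)\le\delta(x,y)+f(y)$ for all $x,y\in X$. $X$ and $Y$ are nonempty. A (max,+)-isomorphism is an invertible map commuting with pairwise pointwise suprema and with the addition of real constants ($J(f+\lambda)=Jf+\lambda$ for $\lambda\in\mathbb R$).
   Formalization: That g is nonexpansive is asserted only when δ' is nonnegative; for weak metrics with negative values it can fail (two points, δ(a,b)=−1, δ(b,a)=3, J the identity gives g=0, which is not nonexpansive). All other claims are unconditional. *)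

theory Defs
  imports "HOL-Analysis.Abstract_Metric_Spaces"
begin

definition symmetrized :: "('a \<Rightarrow> 'a \<Rightarrow> real) \<Rightarrow> 'a \<Rightarrow> 'a \<Rightarrow> real" where
  "symmetrized \<delta> x y = \<delta> x y + \<delta> y x"

definition weak_metric :: "('a \<Rightarrow> 'a \<Rightarrow> real) \<Rightarrow> bool" where
  "weak_metric \<delta> \<longleftrightarrow>
     (\<forall>x y z. \<delta> x z \<le> \<delta> x y + \<delta> y z) \<and> Metric_space UNIV (symmetrized \<delta>)"

definition nonexpansive :: "('a \<Rightarrow> 'a \<Rightarrow> real) \<Rightarrow> ('a \<Rightarrow> real) \<Rightarrow> bool" where
  "nonexpansive \<delta> f \<longleftrightarrow> (\<forall>x y. f x \<le> \<delta> x y + f y)"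

definition compact_closed_balls :: "('a \<Rightarrow> 'a \<Rightarrow> real) \<Rightarrow> bool" where
  "compact_closed_balls d \<longleftrightarrow>
     (\<forall>x r. compactin (Metric_space.mtopology UNIV d) (Metric_space.mcball UNIV d x r))"

definition balls_compact_or_symmetric_complete :: "('a \<Rightarrow> 'a \<Rightarrow> real) \<Rightarrow> bool" where
  "balls_compact_or_symmetric_complete \<delta> \<longleftrightarrow>
     compact_closed_balls (symmetrized \<delta>) \<or>
     (\<forall>x y. \<delta> x y = 1 / 2 * symmetrized \<delta> x y) \<and>
       Metric_space.mcomplete UNIV (symmetrized \<delta>)"

(* The values of J outside F are irrelevant. *)
definition maxplus_isomorphism ::
    "('b \<Rightarrow> real) set \<Rightarrow> ('a \<Rightarrow> real) set \<Rightarrow> (('b \<Rightarrow> real) \<Rightarrow> 'a \<Rightarrow> real) \<Rightarrow> bool" where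
  "maxplus_isomorphism F G J \<longleftrightarrow>
     bij_betw J F G \<and>
     (\<forall>f\<in>F. \<forall>h\<in>F. J (\<lambda>y. max (f y) (h y)) = (\<lambda>x. max (J f x) (J h x))) \<and>
     (\<forall>f\<in>F. \<forall>c. J (\<lambda>y. f y + c) = (\<lambda>x. J f x + c))"

(* For a weak metric with negative values the additive part g of a (max,+)-isomorphism
   J f x = g x + f (\<phi> x) need not be nonexpansive.  In fact
   g x - g x' + \<delta>' (\<phi> x) (\<phi> x') = \<delta> x x' shows that g is nonexpansive exactly when
   \<delta>' is nonnegative on the range of \<phi>.  A two-point counterexample with J = id: *)
lemma additive_part_not_nonexpansive:
  defines "\<delta> \<equiv> (\<lambda>x y. if x = y then 0 else if x then - 1 else 3) :: bool \<Rightarrow> bool \<Rightarrow> real"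
  defines "F \<equiv> {f. nonexpansive \<delta> f}"
  shows "weak_metric \<delta>"
    and "balls_compact_or_symmetric_complete \<delta>"
    and "maxplus_isomorphism F F (\<lambda>f. f)"
    and "\<nexists>g \<phi>. nonexpansive \<delta> g \<and> (\<forall>f\<in>F. \<forall>x. f x = g x + f (\<phi> x))"
proof -
  have M: "Metric_space UNIV (symmetrized \<delta>)"
    by standard (auto simp: symmetrized_def \<delta>_def)
  show "weak_metric \<delta>"
    unfolding weak_metric_def using M by (auto simp: \<delta>_def)
  show "balls_compact_or_symmetric_complete \<delta>"
    unfolding balls_compact_or_symmetric_complete_def compact_closed_balls_def
    by (simp add: finite_imp_compactin Metric_space.topspace_mtopology[OF M])
  show "maxplus_isomorphism F F (\<lambda>f. f)"
    by (auto simp: maxplus_isomorphism_def bij_betw_def)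
  show "\<nexists>g \<phi>. nonexpansive \<delta> g \<and> (\<forall>f\<in>F. \<forall>x. f x = g x + f (\<phi> x))"
  proof
    assume "\<exists>g \<phi>. nonexpansive \<delta> g \<and> (\<forall>f\<in>F. \<forall>x. f x = g x + f (\<phi> x))"
    then obtain g \<phi> where g: "nonexpansive \<delta> g"
      and eq: "\<And>f x. f \<in> F \<Longrightarrow> f x = g x + f (\<phi> x)" by blast
    define u where "u = (\<lambda>c b. if b then 0 else c :: real)"
    have u: "u 1 \<in> F" "u 3 \<in> F"
      by (auto simp: F_def nonexpansive_def \<delta>_def u_def)
    have "\<phi> x = x" for x
      using eq[OF u(1), of x] eq[OF u(2), of x] by (auto simp: u_def split: if_splits)
    then have "g x = 0" for x using eq[OF u(1), of x] by simp
    moreover have "g True \<le> \<delta> True False + g False"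
      using g by (simp add: nonexpansive_def)
    ultimately show False by (simp add: \<delta>_def)
  qed
qed

end

(* Call p in F approximately generated if for every e > 0 there is a point y with
   p <= p(y) - \<delta>'(y, .) + e.  The functions t - \<delta>(x, .) have the analogue of this property in G, and the
   property is expressed by order and constants only, so it is preserved by J and its
   inverse.  In a complete space, approximating points form a Cauchy sequence and the limit
   generates p exactly.  So the inverse of J sends -\<delta>(x, .) to -\<delta>'(\<phi> x, .) minus a constant g x;
   evaluation at x is dual to -\<delta>(x, .), which gives J f x = g x + f (\<phi> x). *)
theory Submission
  imports Defs
begin

section \<open>Weak metrics and nonexpansive functions\<close>

lemma weak_metric_triangle: "weak_metric \<delta> \<Longrightarrow> \<delta> x z \<le> \<delta> x y + \<delta> y z"
  by (simp add: weak_metric_def)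

lemma weak_metric_Metric_space: "weak_metric \<delta> \<Longrightarrow> Metric_space UNIV (symmetrized \<delta>)"
  by (simp add: weak_metric_def)

lemma weak_metric_self [simp]: "weak_metric \<delta> \<Longrightarrow> \<delta> x x = 0"
  using Metric_space.mdist_zero[OF weak_metric_Metric_space, of \<delta> x]
  by (simp add: symmetrized_def)

lemma nonexpansiveD: "nonexpansive \<delta> f \<Longrightarrow> f x \<le> \<delta> x y + f y"
  by (simp add: nonexpansive_def)

lemma nonexpansive_add_const: "nonexpansive \<delta> f \<Longrightarrow> nonexpansive \<delta> (\<lambda>x. f x + c)"
  by (simp add: nonexpansive_def)

lemma nonexpansive_max:
  "nonexpansive \<delta> f \<Longrightarrow> nonexpansive \<delta> h \<Longrightarrow> nonexpansive \<delta> (\<lambda>x. max (f x) (h x))"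
  unfolding nonexpansive_def by (smt (verit))

lemma nonexpansive_min:
  "nonexpansive \<delta> f \<Longrightarrow> nonexpansive \<delta> h \<Longrightarrow> nonexpansive \<delta> (\<lambda>x. min (f x) (h x))"
  unfolding nonexpansive_def by (smt (verit))

text \<open>Among the nonexpansive functions that vanish at \<open>y\<close>, this one is the
  greatest and the one of the next lemma the least. Both serve as test functions below.\<close>

lemma nonexpansive_weak_metric_left: "weak_metric \<delta> \<Longrightarrow> nonexpansive \<delta> (\<lambda>x. \<delta> x y)"
  by (simp add: nonexpansive_def weak_metric_triangle)

lemma nonexpansive_weak_metric_right: "weak_metric \<delta> \<Longrightarrow> nonexpansive \<delta> (\<lambda>x. - \<delta> y x)"
  unfolding nonexpansive_def using weak_metric_triangle[of \<delta> y] by (smt (verit))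

text \<open>Both alternatives enter only through completeness. With compact balls, a Cauchy sequence
  is bounded, so some subsequence converges, and then so does the whole sequence.\<close>

lemma mcomplete_if_balls_compact_or_symmetric_complete:
  assumes "weak_metric \<delta>" "balls_compact_or_symmetric_complete \<delta>"
  shows "Metric_space.mcomplete UNIV (symmetrized \<delta>)"
proof -
  interpret Metric_space UNIV "symmetrized \<delta>"
    using assms(1) by (rule weak_metric_Metric_space)
  have ?thesis if cpt: "compact_closed_balls (symmetrized \<delta>)"
    unfolding mcomplete_def
  proof (intro allI impI)
    fix \<sigma> assume \<sigma>: "MCauchy \<sigma>"
    then obtain a B where "range \<sigma> \<subseteq> mcball a B"
      using MCauchy_imp_mbounded unfolding mbounded_def by blast
    moreover have "compactin mtopology (mcball a B)"
      using cpt by (simp add: compact_closed_balls_def)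
    ultimately obtain l r where "strict_mono r" "limitin mtopology (\<sigma> \<circ> r) l sequentially"
      unfolding compactin_sequentially by blast
    then show "\<exists>x. limitin mtopology \<sigma> x sequentially"
      using MCauchy_convergent_subsequence[OF \<sigma>] by blast
  qed
  then show ?thesis
    using assms(2) by (auto simp: balls_compact_or_symmetric_complete_def)
qed

lemma approximately_generated_imp_generated:
  assumes wm: "weak_metric \<delta>" and complete: "Metric_space.mcomplete UNIV (symmetrized \<delta>)"
    and p: "nonexpansive \<delta> p"
    and approx: "\<And>\<epsilon>. 0 < \<epsilon> \<Longrightarrow> \<exists>y. \<forall>z. p z \<le> p y - \<delta> y z + \<epsilon>"
  obtains y where "\<And>z. p z = p y - \<delta> y z"
proof -
  interpret Metric_space UNIV "symmetrized \<delta>"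
    using wm by (rule weak_metric_Metric_space)
  have "\<exists>y. \<forall>z. p z \<le> p y - \<delta> y z + inverse (real (Suc n))" for n
    by (rule approx) simp
  then obtain s where s: "\<And>n z. p z \<le> p (s n) - \<delta> (s n) z + inverse (real (Suc n))"
    by metis
  \<comment> \<open>Adding \<open>s\<close> at (\<open>s n\<close>, \<open>m\<close>) and at
    (\<open>s m\<close>, \<open>n\<close>) cancels the values of \<open>p\<close> and leaves
    \<open>symmetrized \<delta> (s m) (s n)\<close> at most the sum of the two errors.\<close>
  have "MCauchy s"
    unfolding MCauchy_def
  proof (intro conjI allI impI)
    fix \<epsilon> :: real assume "0 < \<epsilon>"
    then obtain N where N: "inverse (real (Suc N)) < \<epsilon> / 2"
      using reals_Archimedean[of "\<epsilon> / 2"] by auto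
    have "symmetrized \<delta> (s m) (s n) < \<epsilon>" if "N \<le> m" "N \<le> n" for m n
    proof -
      have "inverse (real (Suc m)) < \<epsilon> / 2" "inverse (real (Suc n)) < \<epsilon> / 2"
        using that by (intro le_less_trans[OF le_imp_inverse_le N]; simp)+
      then show ?thesis
        using s[of "s n" m] s[of "s m" n] unfolding symmetrized_def by linarith
    qed
    then show "\<exists>N. \<forall>n n'. N \<le> n \<longrightarrow> N \<le> n' \<longrightarrow> symmetrized \<delta> (s n) (s n') < \<epsilon>"
      by blast
  qed simp
  then obtain y where y: "limitin mtopology s y sequentially"
    using complete unfolding mcomplete_def by blast
  \<comment> \<open>Replacing \<open>s n\<close> by \<open>y\<close> costs
    \<open>\<delta> (s n) y\<close> by nonexpansiveness and \<open>\<delta> y (s n)\<close> by the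
    triangle inequality. The signs of the two are unknown, but their sum is the symmetrized
    distance, which tends to 0.\<close>
  have "p z \<le> p y - \<delta> y z" for z
  proof (rule field_le_epsilon)
    fix \<epsilon> :: real assume "0 < \<epsilon>"
    then obtain N where N: "inverse (real (Suc N)) < \<epsilon> / 2"
      using reals_Archimedean[of "\<epsilon> / 2"] by auto
    obtain M where M: "\<And>n. M \<le> n \<Longrightarrow> symmetrized \<delta> (s n) y < \<epsilon> / 2"
      using y \<open>0 < \<epsilon>\<close> unfolding limit_metric_sequentially by (meson half_gt_zero)
    define n where "n = max M N"
    have "inverse (real (Suc n)) < \<epsilon> / 2"
      using N by (rule le_less_trans[rotated]) (simp add: n_def le_imp_inverse_le)
    moreover have "\<delta> (s n) y + \<delta> y (s n) < \<epsilon> / 2"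
      using M[of n] by (simp add: n_def symmetrized_def)
    ultimately show "p z \<le> p y - \<delta> y z + \<epsilon>"
      using s[of z n] nonexpansiveD[OF p, of "s n" y] weak_metric_triangle[OF wm, of y z "s n"]
      by linarith
  qed
  moreover have "p y - \<delta> y z \<le> p z" for z
    using nonexpansiveD[OF p, of y z] by simp
  ultimately show thesis
    by (meson that antisym)
qed

section \<open>Order and evaluation under (max,+)-isomorphisms\<close>

lemma maxplus_isomorphism_nonexpansive:
  assumes "maxplus_isomorphism {f. nonexpansive \<delta>' f} {h. nonexpansive \<delta> h} J"
    and "nonexpansive \<delta>' f"
  shows "nonexpansive \<delta> (J f)"
  using assms by (auto simp: maxplus_isomorphism_def bij_betw_def)

lemma maxplus_isomorphism_preimage:
  assumes "maxplus_isomorphism {f. nonexpansive \<delta>' f} {h. nonexpansive \<delta> h} J"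
    and "nonexpansive \<delta> h"
  obtains f where "nonexpansive \<delta>' f" "J f = h"
proof -
  have "h \<in> J ` {f. nonexpansive \<delta>' f}"
    using assms by (simp add: maxplus_isomorphism_def bij_betw_def)
  then show thesis
    using that by blast
qed

text \<open>The order is encoded in the maximum: \<open>f\<close> lies below \<open>h\<close> iff
  their maximum equals \<open>h\<close>. Injectivity on \<open>F\<close> gives the direction from
  images back to arguments, hence the assumption that the maximum is in \<open>F\<close>.\<close>

lemma maxplus_isomorphism_le_iff:
  assumes J: "maxplus_isomorphism F G J" and "f \<in> F" "h \<in> F"
    and max: "(\<lambda>y. max (f y) (h y)) \<in> F"
  shows "(\<forall>x. J f x \<le> J h x) \<longleftrightarrow> (\<forall>y. f y \<le> h y)"
proof -
  have "(\<forall>y. f y \<le> h y) \<longleftrightarrow> (\<lambda>y. max (f y) (h y)) = h"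
    unfolding fun_eq_iff max.absorb_iff2 ..
  also have "\<dots> \<longleftrightarrow> J (\<lambda>y. max (f y) (h y)) = J h"
    using J max \<open>h \<in> F\<close>
    by (auto simp: maxplus_isomorphism_def bij_betw_def inj_on_eq_iff)
  also have "\<dots> \<longleftrightarrow> (\<lambda>x. max (J f x) (J h x)) = J h"
    using J \<open>f \<in> F\<close> \<open>h \<in> F\<close> by (simp add: maxplus_isomorphism_def)
  also have "\<dots> \<longleftrightarrow> (\<forall>x. J f x \<le> J h x)"
    unfolding fun_eq_iff max.absorb_iff2 ..
  finally show ?thesis ..
qed

lemma maxplus_isomorphism_preimage_generated:
  assumes wm: "weak_metric \<delta>" and wm': "weak_metric \<delta>'"
    and complete: "Metric_space.mcomplete UNIV (symmetrized \<delta>')"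
    and J: "maxplus_isomorphism {f. nonexpansive \<delta>' f} {h. nonexpansive \<delta> h} J"
    and p: "nonexpansive \<delta>' p" and Jp: "J p = (\<lambda>z. - \<delta> x z)"
  obtains y where "\<And>z. p z = p y - \<delta>' y z"
proof (rule approximately_generated_imp_generated[OF wm' complete p])
  fix \<epsilon> :: real assume "0 < \<epsilon>"
  have J_mono: "(\<forall>x. J f x \<le> J h x) \<longleftrightarrow> (\<forall>y. f y \<le> h y)"
    if "nonexpansive \<delta>' f" "nonexpansive \<delta>' h" for f h
    using that by (intro maxplus_isomorphism_le_iff[OF J]) (auto intro: nonexpansive_max)
  \<comment> \<open>The least nonexpansive function with value \<open>p y\<close> at
    \<open>y\<close>. It lies below \<open>p\<close> and touches it at \<open>y\<close>, so
    \<open>p\<close> is the pointwise supremum of all \<open>e y\<close>.\<close>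
  define e where "e = (\<lambda>y z. - \<delta>' y z + p y)"
  have e: "nonexpansive \<delta>' (e y)" for y
    unfolding e_def by (intro nonexpansive_add_const nonexpansive_weak_metric_right wm')
  have J_e: "nonexpansive \<delta> (J (e y))" for y
    by (rule maxplus_isomorphism_nonexpansive[OF J e])
  have J_e_le: "J (e y) z \<le> - \<delta> x z" for y z
  proof -
    have "\<forall>z. e y z \<le> p z"
      using nonexpansiveD[OF p, of y] by (simp add: e_def algebra_simps)
    then show ?thesis
      using J_mono[OF e p] Jp by metis
  qed
  show "\<exists>y. \<forall>z. p z \<le> p y - \<delta>' y z + \<epsilon>"
  proof (rule ccontr)
    assume no_generator: "\<nexists>y. \<forall>z. p z \<le> p y - \<delta>' y z + \<epsilon>"
    \<comment> \<open>Closeness at the single point \<open>x\<close> spreads: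
      \<open>J (e y) z\<close> is at least \<open>J (e y) x - \<delta> x z\<close>, and
      \<open>J p z\<close> is \<open>- \<delta> x z\<close>. So a value above
      \<open>- \<epsilon>\<close> at \<open>x\<close> would make \<open>y\<close> an approximate
      generator.\<close>
    have J_e_x: "J (e y) x \<le> - \<epsilon>" for y
    proof (rule ccontr)
      assume "\<not> J (e y) x \<le> - \<epsilon>"
      then have "J p z \<le> J (e y) z + \<epsilon>" for z
        using nonexpansiveD[OF J_e, of y x z] Jp by simp
      moreover have "J (\<lambda>z. e y z + \<epsilon>) = (\<lambda>z. J (e y) z + \<epsilon>)"
        using J e by (simp add: maxplus_isomorphism_def)
      ultimately have "\<forall>z. p z \<le> e y z + \<epsilon>"
        using J_mono[OF p nonexpansive_add_const[OF e]] by metis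
      then show False
        using no_generator by (auto simp: e_def add.commute)
    qed
    text \<open>A member of G lying above every \<^term>\<open>J (e y)\<close> but strictly below \<^term>\<open>J p\<close> at \<^term>\<open>x\<close>:
      impossible, as \<^term>\<open>p\<close> is the supremum of the functions \<^term>\<open>e y\<close>.\<close>
    define k where "k = (\<lambda>z. min (- \<delta> x z) (\<delta> z x + - \<epsilon>))"
    have "nonexpansive \<delta> k"
      unfolding k_def
      by (intro nonexpansive_min nonexpansive_add_const nonexpansive_weak_metric_left
          nonexpansive_weak_metric_right wm)
    then obtain q where q: "nonexpansive \<delta>' q" "J q = k"
      by (rule maxplus_isomorphism_preimage[OF J])
    \<comment> \<open>The second term of \<open>k\<close> is the greatest nonexpansive function with
      value \<open>- \<epsilon>\<close> at \<open>x\<close>, so it dominates every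
      \<open>J (e y)\<close>.\<close>
    have "J (e y) z \<le> k z" for y z
      using J_e_le[of y z] nonexpansiveD[OF J_e, of y z x] J_e_x[of y] by (simp add: k_def)
    then have "e y z \<le> q z" for y z
      using J_mono[OF e q(1)] q(2) by metis
    from this[of y y for y] have "\<forall>y. p y \<le> q y"
      using wm' by (simp add: e_def)
    then have "J p x \<le> k x"
      using J_mono[OF p q(1)] q(2) by metis
    then show False
      using \<open>0 < \<epsilon>\<close> wm by (simp add: Jp k_def)
  qed
qed (rule that)

text \<open>For nonexpansive \<open>h\<close>, a real \<open>t\<close> is at most \<open>h x\<close>
  iff \<open>t - \<delta> x z\<close> is at most \<open>h z\<close> for all \<open>z\<close>. Taking
  \<open>h\<close> to be \<open>J f\<close> and pulling this comparison back along \<open>J\<close>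
  gives the same condition for \<open>f\<close> at the generator \<open>y\<close> of the preimage,
  shifted by \<open>p y\<close>.\<close>

lemma maxplus_isomorphism_pointwise_form:
  assumes wm: "weak_metric \<delta>" and wm': "weak_metric \<delta>'"
    and complete: "Metric_space.mcomplete UNIV (symmetrized \<delta>')"
    and J: "maxplus_isomorphism {f. nonexpansive \<delta>' f} {h. nonexpansive \<delta> h} J"
  obtains c y where "\<And>f. nonexpansive \<delta>' f \<Longrightarrow> J f x = c + f y"
proof -
  obtain p where p: "nonexpansive \<delta>' p" "J p = (\<lambda>z. - \<delta> x z)"
    using maxplus_isomorphism_preimage[OF J nonexpansive_weak_metric_right[OF wm, of x]] .
  obtain y where y: "\<And>z. p z = p y - \<delta>' y z"
    using maxplus_isomorphism_preimage_generated[OF wm wm' complete J p] by blast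
  have le_iff: "t \<le> J f x \<longleftrightarrow> t \<le> - p y + f y" if f: "nonexpansive \<delta>' f" for f t
  proof -
    have Jf: "nonexpansive \<delta> (J f)"
      by (rule maxplus_isomorphism_nonexpansive[OF J f])
    have "t \<le> J f x \<longleftrightarrow> (\<forall>z. J p z + t \<le> J f z)"
    proof
      assume "t \<le> J f x"
      then show "\<forall>z. J p z + t \<le> J f z"
        using nonexpansiveD[OF Jf, of x] p(2) by (smt (verit))
    next
      assume "\<forall>z. J p z + t \<le> J f z"
      from spec[OF this, of x] show "t \<le> J f x"
        using p(2) wm by simp
    qed
    also have "\<dots> \<longleftrightarrow> (\<forall>z. J (\<lambda>z. p z + t) z \<le> J f z)"
      using J p(1) by (simp add: maxplus_isomorphism_def)
    also have "\<dots> \<longleftrightarrow> (\<forall>z. p z + t \<le> f z)"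
      using f p(1)
      by (intro maxplus_isomorphism_le_iff[OF J])
        (auto intro: nonexpansive_max nonexpansive_add_const)
    also have "\<dots> \<longleftrightarrow> t \<le> - p y + f y"
    proof
      assume "\<forall>z. p z + t \<le> f z"
      from spec[OF this, of y] show "t \<le> - p y + f y" by simp
    next
      assume "t \<le> - p y + f y"
      then show "\<forall>z. p z + t \<le> f z"
        using nonexpansiveD[OF f, of y] y by (smt (verit))
    qed
    finally show ?thesis .
  qed
  \<comment> \<open>Reals with the same lower bounds are equal.\<close>
  show thesis
    by (rule that[of "- p y" y]) (metis le_iff antisym order_refl)
qed

text \<open>Distance functions to a point give both inequalities: the image of the one to
  \<open>\<phi> x'\<close> is nonexpansive, and the one to \<open>x'\<close> has a nonexpansive
  preimage because \<open>J\<close> is onto.\<close>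

lemma weak_metric_eq_if_onto_nonexpansive:
  assumes wm: "weak_metric \<delta>" and wm': "weak_metric \<delta>'"
    and J: "maxplus_isomorphism {f. nonexpansive \<delta>' f} {h. nonexpansive \<delta> h} J"
    and J_eq: "\<And>f x. nonexpansive \<delta>' f \<Longrightarrow> J f x = g x + f (\<phi> x)"
  shows "g x - g x' + \<delta>' (\<phi> x) (\<phi> x') = \<delta> x x'"
proof (rule antisym)
  have "nonexpansive \<delta>' (\<lambda>y. \<delta>' y (\<phi> x'))"
    using wm' by (rule nonexpansive_weak_metric_left)
  moreover from this have "nonexpansive \<delta> (J (\<lambda>y. \<delta>' y (\<phi> x')))"
    by (rule maxplus_isomorphism_nonexpansive[OF J])
  ultimately show "g x - g x' + \<delta>' (\<phi> x) (\<phi> x') \<le> \<delta> x x'"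
    using nonexpansiveD[of \<delta> "J (\<lambda>y. \<delta>' y (\<phi> x'))" x x'] J_eq wm' by simp
next
  obtain f where f: "nonexpansive \<delta>' f" "J f = (\<lambda>z. \<delta> z x')"
    using maxplus_isomorphism_preimage[OF J nonexpansive_weak_metric_left[OF wm, of x']] .
  have "\<delta> x x' = g x + f (\<phi> x)" "0 = g x' + f (\<phi> x')"
    using J_eq[OF f(1), of x] J_eq[OF f(1), of x'] wm by (simp_all add: f(2))
  then show "\<delta> x x' \<le> g x - g x' + \<delta>' (\<phi> x) (\<phi> x')"
    using nonexpansiveD[OF f(1), of "\<phi> x" "\<phi> x'"] by simp
qed

theorem theorem33:
  fixes \<delta> :: "'a \<Rightarrow> 'a \<Rightarrow> real"
    and \<delta>' :: "'b \<Rightarrow> 'b \<Rightarrow> real"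
    and J :: "('b \<Rightarrow> real) \<Rightarrow> ('a \<Rightarrow> real)"
  assumes "weak_metric \<delta>" and "weak_metric \<delta>'"
    and "balls_compact_or_symmetric_complete \<delta>"
    and "balls_compact_or_symmetric_complete \<delta>'"
    and "maxplus_isomorphism {f. nonexpansive \<delta>' f} {h. nonexpansive \<delta> h} J"
  shows "\<exists>(g :: 'a \<Rightarrow> real) (\<phi> :: 'a \<Rightarrow> 'b).
      (\<forall>f. nonexpansive \<delta>' f \<longrightarrow> (\<forall>x. J f x = g x + f (\<phi> x))) \<and>
      ((\<forall>y y'. 0 \<le> \<delta>' y y') \<longrightarrow> nonexpansive \<delta> g) \<and>
      (\<forall>x x'. g x - g x' + \<delta>' (\<phi> x) (\<phi> x') = \<delta> x x') \<and>
      (Metric_space UNIV \<delta> \<and> Metric_space UNIV \<delta>' \<longrightarrow>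
         (\<exists>c. \<forall>x. g x = c) \<and> (\<forall>x x'. \<delta>' (\<phi> x) (\<phi> x') = \<delta> x x'))"
proof -
  note complete' = mcomplete_if_balls_compact_or_symmetric_complete[OF assms(2,4)]
  have "\<exists>c y. \<forall>f. nonexpansive \<delta>' f \<longrightarrow> J f x = c + f y" for x
    using maxplus_isomorphism_pointwise_form[OF assms(1,2) complete' assms(5), of x] by metis
  then obtain g \<phi> where J_eq: "\<And>f x. nonexpansive \<delta>' f \<Longrightarrow> J f x = g x + f (\<phi> x)"
    by metis
  have \<delta>_eq: "g x - g x' + \<delta>' (\<phi> x) (\<phi> x') = \<delta> x x'" for x x'
    using weak_metric_eq_if_onto_nonexpansive[OF assms(1,2,5) J_eq] .
  \<comment> \<open>By \<open>\<delta>_eq\<close>, \<open>g x - g x'\<close> falls short of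
    \<open>\<delta> x x'\<close> by exactly \<open>\<delta>' (\<phi> x) (\<phi> x')\<close>. The
    sign condition cannot simply be dropped, by
    \<open>additive_part_not_nonexpansive\<close>.\<close>
  have g: "nonexpansive \<delta> g" if "\<forall>y y'. 0 \<le> \<delta>' y y'"
    unfolding nonexpansive_def
  proof (intro allI)
    fix x x'
    have "0 \<le> \<delta>' (\<phi> x) (\<phi> x')" using that by blast
    then show "g x \<le> \<delta> x x' + g x'" using \<delta>_eq[of x x'] by linarith
  qed
  \<comment> \<open>Swapping \<open>x\<close> and \<open>x'\<close> changes the sign of
    \<open>g x - g x'\<close> but neither distance, so the difference vanishes.\<close>
  have "g x = g x'" if "Metric_space UNIV \<delta>" "Metric_space UNIV \<delta>'" for x x'
    using \<delta>_eq[of x x'] \<delta>_eq[of x' x] Metric_space.commute[OF that(1), of x x']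
      Metric_space.commute[OF that(2), of "\<phi> x" "\<phi> x'"]
    by linarith
  then have "(\<exists>c. \<forall>x. g x = c) \<and> (\<forall>x x'. \<delta>' (\<phi> x) (\<phi> x') = \<delta> x x')"
    if "Metric_space UNIV \<delta>" "Metric_space UNIV \<delta>'"
    using that \<delta>_eq by (metis add_0 diff_self)
  then show ?thesis
    using J_eq g \<delta>_eq by blast
qed

end
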